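(* Let $f:\mathbb{R}_+\to\mathbb{C}$ be continuous with $f(0)=0$. Then $$\|f_s\|_{\mathrm{Lip}}\le \sqrt{2}\,\|f\|_{\mathrm{Lip}},$$ and the constant $\sqrt{2}$ is the best possible if the inequality is to hold for all Lipschitz functions $f$; that is, for every $C<\sqrt{2}$ there is a Lipschitz function $f:\mathbb{R}_+\to\mathbb{C}$ with $f(0)=0$ such that $\|f_s\|_{\mathrm{Lip}}> C\|f\|_{\mathrm{Lip}}$. However, if $f$ is real valued, then $$\|f_s\|_{\mathrm{Lip}}=\|f\|_{\mathrm{Lip}}.$$
   Context: Here $\mathbb{R}_+=[0,\infty)$. Let $f:\mathbb{R}_+\to\mathbb{C}$ satisfy $f(0)=0$. For a complex matrix $A$ with singular value decomposition $A=U\Sigma V^*$, i.e. $A=\sum_k s_k(A)\,u_k v_k^*$ with $s_k(A)\ge 0$ the singular values and $(u_k)$, $(v_k)$ orthonormal systems, the singular value functional calculus is defined by $f_s(A)=Uf(\Sigma)V^*=\sum_k f(s_k(A))\,u_k v_k^*$, where $f$ is applied to the singular values on the diagonal of $\Sigma$; since $f(0)=0$ this does not depend on the choice of singular value decomposition. $\|\cdot\|_F$ is the Frobenius norm. Set $$\|f_s\|_{\mathrm{Lip}}=\sup_{A\ne B}\frac{\|f_s(A)-f_s(B)\|_F}{\|A-B\|_F}\in[0,\infty],$$ where the supremum is over pairs of complex matrices $A,B$ of an arbitrary fixed size (the size is omitted from the notation; the assertions hold for every choice of size). Also $$\|f\|_{\mathrm{Lip}}=\sup_{x,y\in\mathbb{R}_+,\,x\ne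 y}\frac{|f(x)-f(y)|}{|x-y|}\in[0,\infty].$$ *)

theory Defs
  imports "HOL-Analysis.Analysis"
begin

text \<open>
  Complex matrices of size $m \times n$ are elements of \<^typ>\<open>complex^'n^'m\<close>, where the index types are
  arbitrary finite (hence nonempty) types.  The library's norm on this type is the Frobenius norm:
\<close>

lemma norm_matrix_frobenius:
  fixes A :: "complex^'n^'m"
  shows "norm A = sqrt (\<Sum>i\<in>UNIV. \<Sum>j\<in>UNIV. (cmod (A $ i $ j))\<^sup>2)"
  by (simp add: norm_vec_def L2_set_def sum_nonneg)

definition orthonormal_system :: "nat \<Rightarrow> (nat \<Rightarrow> complex^'n) \<Rightarrow> bool" where
  "orthonormal_system r u \<longleftrightarrow>
     (\<forall>j<r. \<forall>k<r. (\<Sum>i\<in>UNIV. u j $ i * cnj (u k $ i)) = (if j = k then 1 else 0))"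

text \<open>The matrix $\sum_{k < \min(m,n)} c_k\, u_k v_k^*$.\<close>

definition dyad_sum ::
  "(nat \<Rightarrow> complex) \<Rightarrow> (nat \<Rightarrow> complex^'m) \<Rightarrow> (nat \<Rightarrow> complex^'n) \<Rightarrow> complex^'n^'m" where
  "dyad_sum c u v = (\<chi> i j. \<Sum>k<min CARD('m) CARD('n). c k * u k $ i * cnj (v k $ j))"

definition is_svd ::
  "complex^'n^'m \<Rightarrow> (nat \<Rightarrow> real) \<Rightarrow> (nat \<Rightarrow> complex^'m) \<Rightarrow> (nat \<Rightarrow> complex^'n) \<Rightarrow> bool" where
  "is_svd A s u v \<longleftrightarrow>
     (\<forall>k<min CARD('m) CARD('n). 0 \<le> s k) \<and>
     orthonormal_system (min CARD('m) CARD('n)) u \<and>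
     orthonormal_system (min CARD('m) CARD('n)) v \<and>
     A = dyad_sum (\<lambda>k. complex_of_real (s k)) u v"

text \<open>
  The singular value functional calculus $f_s(A)$.  The description operator is meaningful when
  $f(0) = 0$, since then the result does not depend on the singular value decomposition.
\<close>

definition sv_calculus :: "(real \<Rightarrow> complex) \<Rightarrow> complex^'n^'m \<Rightarrow> complex^'n^'m" where
  "sv_calculus f A =
     (THE X. \<exists>s u v. is_svd A s u v \<and> X = dyad_sum (\<lambda>k. f (s k)) u v)"

definition lip_norm ::
  "'a::real_normed_vector set \<Rightarrow> ('a \<Rightarrow> 'b::real_normed_vector) \<Rightarrow> ennreal" where
  "lip_norm S g =
     (SUP (x, y) \<in> {(x, y). x \<in> S \<and> y \<in> S \<and> x \<noteq> y}. ennreal (norm (g x - g y) / norm (x - y)))"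

end

theory Submission
  imports Defs
begin

text \<open>
  Given singular value decompositions of \<open>A\<close> and \<open>B\<close>, with singular values \<open>s j\<close> and \<open>t k\<close>, the
  squared Frobenius distance of the real combinations \<open>\<Sum> g j u j (v j)*\<close> and \<open>\<Sum> h k u' k (v' k)*\<close>
  is a sum of squares \<open>(g j - h k)\<^sup>2\<close>, \<open>(g j + h k)\<^sup>2\<close>, \<open>(g j)\<^sup>2\<close>, \<open>(h k)\<^sup>2\<close> with nonnegative weights that
  depend only on the singular vectors.  A real Lipschitz function with \<open>f 0 = 0\<close> contracts every one
  of these squares up to the factor \<open>L\<^sup>2\<close>, which settles the real case.  For complex \<open>f\<close> the same
  comparison bounds \<open>\<parallel>X\<parallel>\<^sup>2 + \<parallel>Y\<parallel>\<^sup>2\<close>, where the difference of the images is \<open>X + iY\<close>, with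
  \<open>X\<close> and \<open>Y\<close> coming from the real and imaginary parts of \<open>f\<close>, and
  \<open>\<parallel>X + iY\<parallel>\<^sup>2 \<le> 2 (\<parallel>X\<parallel>\<^sup>2 + \<parallel>Y\<parallel>\<^sup>2)\<close> costs the factor \<open>sqrt 2\<close>.

  The factor is approached already by scalars, where \<open>f\<^sub>s (r e\<^sup>i\<^sup>\<theta>) = f r e\<^sup>i\<^sup>\<theta>\<close>: if at \<open>r = 1\<close> the
  radial derivative is \<open>1\<close> and the tangential factor is \<open>f 1 = - i\<close>, the differential is
  \<open>(x, y) \<mapsto> x + y\<close>, of norm \<open>sqrt 2\<close>.
\<close>

subsection \<open>Hermitian inner product and orthonormal systems\<close>

text \<open>Complex-valued, whereas the library's inner product on these vectors is only its real
  part, see \<open>Re_cip\<close>.\<close>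

definition cip :: "complex^'n \<Rightarrow> complex^'n \<Rightarrow> complex" where
  "cip x y = (\<Sum>i\<in>UNIV. x $ i * cnj (y $ i))"

definition cadj :: "complex^'n^'m \<Rightarrow> complex^'m^'n" where
  "cadj A = (\<chi> j i. cnj (A $ i $ j))"

lemma orthonormal_system_cip:
  "orthonormal_system r u \<longleftrightarrow> (\<forall>j<r. \<forall>k<r. cip (u j) (u k) = (if j = k then 1 else 0))"
  by (simp add: orthonormal_system_def cip_def)

lemma cip_diff_left: "cip (x - y) z = cip x z - cip y z"
  by (simp add: cip_def left_diff_distrib sum_subtractf)

lemma cip_add_left: "cip (x + y) z = cip x z + cip y z"
  by (simp add: cip_def distrib_right sum.distrib)

lemma cip_scale_left: "cip (c *s x) z = c * cip x z"
  by (simp add: cip_def sum_distrib_left mult.assoc)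

lemma cip_scaleR_left: "cip (c *\<^sub>R x) z = of_real c * cip x z"
  by (simp add: cip_def sum_distrib_left mult.assoc scaleR_conv_of_real[where 'a=complex])

lemma cip_sum_left: "cip (\<Sum>k\<in>K. f k) z = (\<Sum>k\<in>K. cip (f k) z)"
  unfolding cip_def by (simp add: sum_distrib_right sum.swap[of _ UNIV])

lemma cip_zero_left [simp]: "cip 0 z = 0"
  by (simp add: cip_def)

lemma cip_zero_right [simp]: "cip x 0 = 0"
  by (simp add: cip_def)

lemma cnj_cip: "cnj (cip x y) = cip y x"
  by (simp add: cip_def mult.commute)

lemma cip_eq_0_sym: "cip x y = 0 \<longleftrightarrow> cip y x = 0"
  by (metis cnj_cip complex_cnj_zero)

lemma Re_cip: "Re (cip x y) = x \<bullet> y"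
  by (simp add: cip_def inner_vec_def inner_complex_def)

lemma cip_self: "cip x x = complex_of_real ((norm x)\<^sup>2)"
  by (simp add: complex_eq_iff Re_cip power2_norm_eq_inner)
    (simp add: cip_def mult.commute)

lemma cip_adj:
  fixes A :: "complex^'n^'m"
  shows "cip (A *v x) y = cip x (cadj A *v y)"
  unfolding cip_def cadj_def matrix_vector_mult_def
  by (simp add: sum_distrib_left sum_distrib_right mult_ac sum.swap[of _ "UNIV :: 'm set"])

lemma cadj_cadj [simp]: "cadj (cadj A) = A"
  by (simp add: cadj_def vec_eq_iff)

lemma orthonormal_norm: "orthonormal_system r u \<Longrightarrow> k < r \<Longrightarrow> norm (u k) = 1"
  using cip_self[of "u k"] by (simp add: orthonormal_system_cip power2_eq_1_iff flip: of_real_power)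
    (metis norm_ge_zero neg_0_le_iff_le not_one_le_zero)

text \<open>The residual is orthogonal to each \<open>u j\<close>, hence to the projection, so its
  inner product with itself equals that of \<open>x\<close> with it.\<close>

lemma Bessel_identity:
  assumes "orthonormal_system r u"
  shows "(norm (x - (\<Sum>k<r. cip x (u k) *s u k)))\<^sup>2 = (norm x)\<^sup>2 - (\<Sum>k<r. (cmod (cip x (u k)))\<^sup>2)"
    and "j < r \<Longrightarrow> cip (x - (\<Sum>k<r. cip x (u k) *s u k)) (u j) = 0"
proof -
  let ?p = "\<Sum>k<r. cip x (u k) *s u k"
  have orth: "cip (x - ?p) (u j) = 0" if "j < r" for j
  proof -
    have "cip ?p (u j) = (\<Sum>k<r. cip x (u k) * (if k = j then 1 else 0))"
      unfolding cip_sum_left using assms that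
      by (intro sum.cong) (auto simp: cip_scale_left orthonormal_system_cip)
    also have "\<dots> = cip x (u j)"
      using that by (simp add: if_distrib[of "\<lambda>c. _ * c"] cong: if_cong)
    finally show ?thesis by (simp add: cip_diff_left)
  qed
  show "j < r \<Longrightarrow> cip (x - ?p) (u j) = 0" by (rule orth)
  have "cip ?p (x - ?p) = 0"
    unfolding cip_sum_left
    by (intro sum.neutral) (use orth in \<open>auto simp: cip_scale_left cip_eq_0_sym[of "u _"]\<close>)
  then have "cip (x - ?p) (x - ?p) = cip x (x - ?p)"
    by (simp add: cip_diff_left)
  also have "\<dots> = cnj (cip x x - (\<Sum>k<r. cip x (u k) * cip (u k) x))"
    by (subst cnj_cip[symmetric]) (simp add: cip_diff_left cip_sum_left cip_scale_left)
  also have "\<dots> = complex_of_real ((norm x)\<^sup>2 - (\<Sum>k<r. (cmod (cip x (u k)))\<^sup>2))"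
    by (simp add: cip_self cnj_cip mult.commute complex_norm_square del: of_real_power)
  finally show "(norm (x - ?p))\<^sup>2 = (norm x)\<^sup>2 - (\<Sum>k<r. (cmod (cip x (u k)))\<^sup>2)"
    unfolding cip_self of_real_eq_iff .
qed

lemma Bessel_inequality:
  assumes "orthonormal_system r u"
  shows "(\<Sum>k<r. (cmod (cip x (u k)))\<^sup>2) \<le> (norm x)\<^sup>2"
  using zero_le_power2[of "norm (x - (\<Sum>k<r. cip x (u k) *s u k))"]
  unfolding Bessel_identity(1)[OF assms] by simp

text \<open>This is the trace, in the standard basis, of the orthogonal projection onto the span of
  \<open>u\<close>; it recovers the dimension.\<close>

lemma orthonormal_trace:
  fixes u :: "nat \<Rightarrow> complex^'n"
  assumes "orthonormal_system r u"
  shows "(\<Sum>i\<in>UNIV. \<Sum>k<r. (cmod (cip (axis i 1) (u k)))\<^sup>2) = real r"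
proof -
  have "cip (axis i 1) (u k) = cnj (u k $ i)" for i k
    by (simp add: cip_def axis_def if_distrib[of "\<lambda>x. x * _"] cong: if_cong)
  then have "(\<Sum>i\<in>UNIV. \<Sum>k<r. (cmod (cip (axis i 1) (u k)))\<^sup>2)
    = (\<Sum>k<r. \<Sum>i\<in>UNIV. (cmod (u k $ i))\<^sup>2)"
    by (simp add: sum.swap[of _ "UNIV :: 'n set"])
  also have "\<dots> = (\<Sum>k<r. (norm (u k))\<^sup>2)"
    by (simp add: norm_vec_def L2_set_def sum_nonneg)
  also have "\<dots> = real r"
    using orthonormal_norm[OF assms] by simp
  finally show ?thesis .
qed

lemma norm_axis_one: "norm (axis i (1::complex) :: complex^'n) = 1"
  by (simp add: norm_vec_def L2_set_def axis_def if_distrib[of norm] if_distrib[of "\<lambda>x. x ^ _"] cong: if_cong)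

text \<open>By Bessel's inequality each standard basis vector contributes at most 1 to the
  trace.\<close>

lemma orthonormal_card_le:
  fixes u :: "nat \<Rightarrow> complex^'n"
  assumes "orthonormal_system r u"
  shows "r \<le> CARD('n)"
proof -
  have "real r \<le> (\<Sum>i\<in>(UNIV::'n set). 1)"
    unfolding orthonormal_trace[OF assms, symmetric]
    by (intro sum_mono order.trans[OF Bessel_inequality[OF assms]]) (simp add: norm_axis_one)
  then show ?thesis by simp
qed

text \<open>If only 0 were orthogonal to all \<open>u k\<close>, the Bessel residual of every
  standard basis vector would vanish, and the trace would be the full dimension instead of
  \<open>r\<close>.\<close>

lemma orthonormal_extension:
  fixes u :: "nat \<Rightarrow> complex^'n"
  assumes "orthonormal_system r u" "r < CARD('n)"
  shows "\<exists>x. norm x = 1 \<and> (\<forall>k<r. cip x (u k) = 0)"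
proof (rule ccontr)
  assume neg: "\<not> ?thesis"
  have zero: "x = 0" if "\<forall>k<r. cip x (u k) = 0" for x
  proof (rule ccontr)
    assume "x \<noteq> 0"
    then have "norm ((1 / norm x) *\<^sub>R x) = 1" "\<forall>k<r. cip ((1 / norm x) *\<^sub>R x) (u k) = 0"
      using that by (simp_all add: cip_scaleR_left)
    with neg show False by blast
  qed
  have "(\<Sum>k<r. (cmod (cip (axis i 1) (u k)))\<^sup>2) = 1" for i :: 'n
  proof -
    have "axis i 1 - (\<Sum>k<r. cip (axis i 1) (u k) *s u k) = 0"
      using Bessel_identity(2)[OF assms(1)] by (intro zero allI impI)
    from Bessel_identity(1)[OF assms(1), of "axis i 1", unfolded this norm_axis_one] show ?thesis
      by simp
  qed
  then show False
    using orthonormal_trace[OF assms(1)] assms(2) by simp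
qed

lemma orthonormal_Suc:
  assumes "orthonormal_system r u" "norm x = 1" "\<And>k. k < r \<Longrightarrow> cip x (u k) = 0"
  shows "orthonormal_system (Suc r) (u(r := x))"
  using assms cip_self[of x] cip_eq_0_sym[of x]
  by (auto simp: orthonormal_system_cip less_Suc_eq)

lemma orthonormal_basis_separates:
  fixes v :: "nat \<Rightarrow> complex^'n"
  assumes "orthonormal_system CARD('n) v" "\<And>k. k < CARD('n) \<Longrightarrow> cip x (v k) = 0"
  shows "x = 0"
proof (rule ccontr)
  assume "x \<noteq> 0"
  then have "orthonormal_system (Suc CARD('n)) (v(CARD('n) := (1 / norm x) *\<^sub>R x))"
    using assms by (intro orthonormal_Suc) (simp_all add: cip_scaleR_left)
  from orthonormal_card_le[OF this] show False by simp
qed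

text \<open>Each row, once conjugated, is orthogonal to a full orthonormal basis.\<close>

lemma matrix_zero_on_orthonormal_basis:
  fixes A :: "complex^'n^'m"
  assumes "orthonormal_system CARD('n) v" "\<And>k. k < CARD('n) \<Longrightarrow> A *v v k = 0"
  shows "A = 0"
proof -
  have "(\<chi> j. cnj (A $ i $ j)) = 0" for i
  proof (rule orthonormal_basis_separates[OF assms(1)])
    fix k assume "k < CARD('n)"
    have "cip (\<chi> j. cnj (A $ i $ j)) (v k) = cnj ((A *v v k) $ i)"
      by (simp add: cip_def matrix_vector_mult_def)
    then show "cip (\<chi> j. cnj (A $ i $ j)) (v k) = 0"
      using assms(2)[OF \<open>k < _\<close>] by simp
  qed
  then show ?thesis by (simp add: vec_eq_iff)
qed

lemma cadj_eq_0: "cadj A = 0 \<longleftrightarrow> A = 0"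
  by (auto simp: cadj_def vec_eq_iff)

subsection \<open>Existence of singular value decompositions\<close>

text \<open>The normalized \<open>w\<close> is itself a competitor, so \<open>w \<bullet> y\<close>
  attains the Cauchy-Schwarz bound, and equality forces parallel vectors.\<close>

lemma maximizer_aligned:
  fixes w y :: "'a::real_inner"
  assumes "subspace W" "w \<in> W" "norm y = 1"
    and max: "\<And>z. z \<in> W \<Longrightarrow> norm z = 1 \<Longrightarrow> w \<bullet> z \<le> w \<bullet> y"
  shows "w = (w \<bullet> y) *\<^sub>R y"
proof (cases "w = 0")
  case False
  have "w \<bullet> ((1 / norm w) *\<^sub>R w) \<le> w \<bullet> y"
    using False assms by (intro max subspace_scale) auto
  then have "norm w \<le> w \<bullet> y"
    using False by (simp flip: power2_norm_eq_inner add: power2_eq_square)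
  moreover have "w \<bullet> y \<le> norm w * norm y" by (rule norm_cauchy_schwarz)
  ultimately have "w \<bullet> y = norm w * norm y" "w \<bullet> y = norm w" using assms by simp_all
  then show ?thesis using assms(3) norm_cauchy_schwarz_eq[of w y] by simp
qed simp

lemma subspace_cip: "subspace {x. \<forall>k<r. cip x (v k) = 0}"
  by (auto simp: subspace_def cip_scaleR_left cip_add_left)

lemma closed_cip: "closed {x. \<forall>k<(r::nat). cip x (v k) = 0}"
proof -
  have "{x. \<forall>k<r. cip x (v k) = 0} = (\<Inter>k<r. {x. cip x (v k) = 0})" by auto
  then show ?thesis
    unfolding cip_def by (auto intro!: closed_Inter closed_Collect_eq continuous_intros)
qed

text \<open>Maximize the real inner product of \<open>R x\<close> and \<open>y\<close> over unit vectors orthogonal to the singular vectors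
  found so far; at a maximum \<open>R x\<close> is parallel to \<open>y\<close> and the adjoint image of \<open>y\<close> is parallel to \<open>x\<close>.\<close>

lemma top_singular_pair:
  fixes R :: "complex^'n^'m"
  assumes u: "orthonormal_system r u" and v: "orthonormal_system r v"
    and Rv: "\<And>k. k < r \<Longrightarrow> R *v v k = 0" and Ru: "\<And>k. k < r \<Longrightarrow> cadj R *v u k = 0"
    and r: "r < min CARD('m) CARD('n)"
  obtains \<sigma> x y where "0 \<le> \<sigma>" "norm x = 1" "norm y = 1"
    "\<And>k. k < r \<Longrightarrow> cip x (v k) = 0" "\<And>k. k < r \<Longrightarrow> cip y (u k) = 0"
    "R *v x = \<sigma> *\<^sub>R y" "cadj R *v y = \<sigma> *\<^sub>R x"
proof -
  let ?V = "{x. \<forall>k<r. cip x (v k) = 0}" and ?U = "{x. \<forall>k<r. cip x (u k) = 0}"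
  let ?S = "(sphere 0 1 \<inter> ?V) \<times> (sphere 0 1 \<inter> ?U)"
  have "compact ?S"
    by (intro compact_Times compact_Int_closed closed_cip compact_sphere)
  moreover have "?S \<noteq> {}"
    using orthonormal_extension[OF u] orthonormal_extension[OF v] r by auto
  moreover have "continuous_on ?S (\<lambda>z. (R *v fst z) \<bullet> snd z)"
    unfolding matrix_vector_mult_def by (intro continuous_intros)
  ultimately obtain z where z: "z \<in> ?S" "\<forall>z'\<in>?S. (R *v fst z') \<bullet> snd z' \<le> (R *v fst z) \<bullet> snd z"
    using continuous_attains_sup[of ?S "\<lambda>z. (R *v fst z) \<bullet> snd z"] by blast
  obtain x y where xy: "z = (x, y)" by (cases z)
  define \<sigma> where "\<sigma> = (R *v x) \<bullet> y"
  have x: "norm x = 1" "x \<in> ?V" and y: "norm y = 1" "y \<in> ?U" using z(1) xy by auto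
  have max: "(R *v x') \<bullet> y' \<le> \<sigma>" if "x' \<in> ?V" "norm x' = 1" "y' \<in> ?U" "norm y' = 1" for x' y'
    using z(2)[rule_format, of "(x', y')"] that by (simp add: \<sigma>_def xy)
  have adj: "(cadj R *v y') \<bullet> x' = (R *v x') \<bullet> y'" for x' y'
    by (metis Re_cip cip_adj inner_commute)
  \<comment> \<open>The vector \<open>- y\<close> is admissible too, which makes the maximum
    nonnegative.\<close>
  have "(R *v x) \<bullet> (- y) \<le> \<sigma>"
    using x y subspace_neg[OF subspace_cip y(2)] by (intro max) auto
  then have \<sigma>: "0 \<le> \<sigma>" by (simp add: \<sigma>_def)
  \<comment> \<open>With \<open>x\<close> fixed, \<open>y\<close> is a maximizer over
    \<open>?U\<close>, and \<open>Ru\<close> puts \<open>R *v x\<close> itself into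
    \<open>?U\<close>.\<close>
  have Rx: "R *v x = ((R *v x) \<bullet> y) *\<^sub>R y"
  proof (rule maximizer_aligned[OF subspace_cip[of r u] _ y(1)])
    show "R *v x \<in> ?U" using Ru by (simp add: cip_adj)
    show "(R *v x) \<bullet> z \<le> (R *v x) \<bullet> y" if "z \<in> ?U" "norm z = 1" for z
      using max x that by (simp add: \<sigma>_def)
  qed
  have Ry: "cadj R *v y = ((cadj R *v y) \<bullet> x) *\<^sub>R x"
  proof (rule maximizer_aligned[OF subspace_cip[of r v] _ x(1)])
    show "cadj R *v y \<in> ?V" using Rv by (simp add: cip_adj)
    show "(cadj R *v y) \<bullet> z \<le> (cadj R *v y) \<bullet> x" if "z \<in> ?V" "norm z = 1" for z
      using max y that by (simp add: \<sigma>_def adj)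
  qed
  show ?thesis
    by (rule that[OF \<sigma> x(1) y(1) _ _ Rx[folded \<sigma>_def] Ry[unfolded adj, folded \<sigma>_def]])
      (use x(2) y(2) in auto)
qed

definition dyad :: "complex^'m \<Rightarrow> complex^'n \<Rightarrow> complex^'n^'m" where
  "dyad x y = (\<chi> i j. x $ i * cnj (y $ j))"

lemma dyad_mult_vec: "dyad x y *v z = cip z y *s x"
  by (simp add: vec_eq_iff dyad_def matrix_vector_mult_def cip_def sum_distrib_left mult_ac)

lemma cadj_dyad: "cadj (dyad x y) = dyad y x"
  by (simp add: vec_eq_iff dyad_def cadj_def mult.commute)

lemma cadj_diff: "cadj (A - B) = cadj A - cadj B"
  by (simp add: vec_eq_iff cadj_def)

lemma cadj_scaleR: "cadj (c *\<^sub>R A) = c *\<^sub>R cadj A"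
  by (simp add: vec_eq_iff cadj_def)

lemma matrix_vec_scaleR: "(c *\<^sub>R A) *v x = c *\<^sub>R (A *v x)" for A :: "complex^'n^'m"
  by (simp add: vec_eq_iff matrix_vector_mult_def scaleR_right.sum)

text \<open>Deflation: the two annihilation properties of the residual are what
  \<open>top_singular_pair\<close> needs to produce the next pair. Subtracting the new dyad kills
  the new vectors, and orthogonality preserves the earlier zeros.\<close>

lemma partial_svd:
  fixes A :: "complex^'n^'m"
  assumes "r \<le> min CARD('m) CARD('n)"
  shows "\<exists>s u v. (\<forall>k<r. 0 \<le> s k) \<and> orthonormal_system r u \<and> orthonormal_system r v \<and>
    (\<forall>k<r. (A - (\<Sum>k<r. s k *\<^sub>R dyad (u k) (v k))) *v v k = 0) \<and>
    (\<forall>k<r. cadj (A - (\<Sum>k<r. s k *\<^sub>R dyad (u k) (v k))) *v u k = 0)"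
  using assms
proof (induction r)
  case 0
  then show ?case by (simp add: orthonormal_system_def)
next
  case (Suc r)
  define N where "N = min CARD('m) CARD('n)"
  from Suc obtain s u v where IH: "\<forall>k<r. 0 \<le> s k" "orthonormal_system r u" "orthonormal_system r v"
    "\<forall>k<r. (A - (\<Sum>k<r. s k *\<^sub>R dyad (u k) (v k))) *v v k = 0"
    "\<forall>k<r. cadj (A - (\<Sum>k<r. s k *\<^sub>R dyad (u k) (v k))) *v u k = 0"
    by auto
  define R where "R = A - (\<Sum>k<r. s k *\<^sub>R dyad (u k) (v k))"
  have "r < N" using Suc.prems by (simp add: N_def)
  then obtain \<sigma> x y where sxy: "0 \<le> \<sigma>" "norm x = 1" "norm y = 1"
    "\<And>k. k < r \<Longrightarrow> cip x (v k) = 0" "\<And>k. k < r \<Longrightarrow> cip y (u k) = 0"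
    "R *v x = \<sigma> *\<^sub>R y" "cadj R *v y = \<sigma> *\<^sub>R x"
    using IH by (elim top_singular_pair[of r u v R]) (simp_all add: R_def N_def)
  let ?s = "s(r := \<sigma>)" and ?u = "u(r := y)" and ?v = "v(r := x)"
  have R': "A - (\<Sum>k<Suc r. ?s k *\<^sub>R dyad (?u k) (?v k)) = R - \<sigma> *\<^sub>R dyad y x"
    by (simp add: R_def)
  have cipxx: "cip x x = 1" "cip y y = 1" using sxy by (simp_all add: cip_self)
  have kill: "cip (v k) x = 0" "cip (u k) y = 0" "R *v v k = 0" "cadj R *v u k = 0" if "k < r" for k
    using sxy(4,5)[OF that] IH(4,5) that by (simp_all add: cip_eq_0_sym[of "v k"] cip_eq_0_sym[of "u k"] R_def)
  have Rv: "(R - \<sigma> *\<^sub>R dyad y x) *v ?v k = 0" if "k < Suc r" for k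
    using that kill[of k] cipxx
    by (cases "k = r") (simp_all add: matrix_vector_mult_diff_rdistrib matrix_vec_scaleR dyad_mult_vec sxy(6))
  have Ru: "cadj (R - \<sigma> *\<^sub>R dyad y x) *v ?u k = 0" if "k < Suc r" for k
    using that kill[of k] cipxx
    by (cases "k = r") (simp_all add: cadj_diff cadj_scaleR cadj_dyad
        matrix_vector_mult_diff_rdistrib matrix_vec_scaleR dyad_mult_vec sxy(7))
  have s: "0 \<le> ?s k" if "k < Suc r" for k
    using IH(1) sxy(1) that by (auto simp: less_Suc_eq)
  have u: "orthonormal_system (Suc r) ?u"
    by (rule orthonormal_Suc[OF IH(2) sxy(3,5)])
  have v: "orthonormal_system (Suc r) ?v"
    by (rule orthonormal_Suc[OF IH(3) sxy(2,4)])
  show ?case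
    by (rule exI[of _ ?s], rule exI[of _ ?u], rule exI[of _ ?v], unfold R', intro conjI allI impI)
      (rule s u v Rv Ru, assumption?)+
qed

text \<open>Real coefficients make the sum a real linear combination, which the library's real inner
  product can expand.\<close>

lemma dyad_sum_of_real:
  fixes u :: "nat \<Rightarrow> complex^'m" and v :: "nat \<Rightarrow> complex^'n"
  shows "dyad_sum (\<lambda>k. complex_of_real (g k)) u v
    = (\<Sum>k<min CARD('m) CARD('n). g k *\<^sub>R dyad (u k) (v k))"
  unfolding dyad_sum_def dyad_def
  by (simp add: vec_eq_iff scaleR_conv_of_real[where 'a=complex] mult.assoc)

text \<open>After \<open>N\<close> deflations one of the two systems is a full basis, so the
  residual or its adjoint vanishes.\<close>

lemma svd_exists:
  fixes A :: "complex^'n^'m"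
  shows "\<exists>s u v. is_svd A s u v"
proof -
  define N where "N = min CARD('m) CARD('n)"
  obtain s u v where suv: "\<forall>k<N. 0 \<le> s k" "orthonormal_system N u" "orthonormal_system N v"
    "\<forall>k<N. (A - (\<Sum>k<N. s k *\<^sub>R dyad (u k) (v k))) *v v k = 0"
    "\<forall>k<N. cadj (A - (\<Sum>k<N. s k *\<^sub>R dyad (u k) (v k))) *v u k = 0"
    using partial_svd[of N A] by (auto simp: N_def)
  have "A - (\<Sum>k<N. s k *\<^sub>R dyad (u k) (v k)) = 0"
  proof (cases "N = CARD('n)")
    case True
    then show ?thesis using suv by (intro matrix_zero_on_orthonormal_basis[of v]) auto
  next
    case False
    then have "N = CARD('m)" by (simp add: N_def min_def split: if_splits)
    then have "cadj (A - (\<Sum>k<N. s k *\<^sub>R dyad (u k) (v k))) = 0"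
      using suv by (intro matrix_zero_on_orthonormal_basis[of u]) auto
    then show ?thesis by (simp add: cadj_eq_0)
  qed
  then have "A = dyad_sum (\<lambda>k. complex_of_real (s k)) u v"
    by (simp add: dyad_sum_of_real N_def)
  then have "is_svd A s u v"
    unfolding is_svd_def N_def[symmetric] by (intro conjI suv)
  then show ?thesis by (intro exI)
qed

subsection \<open>The Lipschitz estimate\<close>

lemma inner_dyad: "dyad x y \<bullet> dyad x' y' = Re (cip x x' * cnj (cip y y'))"
proof -
  have "cip x x' * cnj (cip y y') = (\<Sum>i\<in>UNIV. \<Sum>j\<in>UNIV. (x $ i * cnj (y $ j)) * cnj (x' $ i * cnj (y' $ j)))"
    unfolding cip_def cnj_sum sum_product by (simp add: mult_ac)
  moreover have "z \<bullet> w = Re (z * cnj w)" for z w :: complex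
    by (simp add: inner_complex_def)
  ultimately show ?thesis
    by (simp only: inner_vec_def dyad_def vec_lambda_beta Re_sum)
qed

lemma inner_dyad_sum:
  fixes u u' :: "nat \<Rightarrow> complex^'m" and v v' :: "nat \<Rightarrow> complex^'n"
  shows "dyad_sum (\<lambda>k. of_real (g k)) u v \<bullet> dyad_sum (\<lambda>k. of_real (h k)) u' v'
    = (\<Sum>j<min CARD('m) CARD('n). \<Sum>k<min CARD('m) CARD('n).
        g j * h k * Re (cip (u j) (u' k) * cnj (cip (v j) (v' k))))"
  unfolding dyad_sum_of_real inner_sum_left
  unfolding inner_sum_right inner_scaleR_left inner_scaleR_right inner_dyad sum_distrib_left
  by (simp only: mult.assoc mult.left_commute)

text \<open>Orthonormality on both sides makes the dyads orthonormal, so this is Parseval's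
  identity.\<close>

lemma norm_dyad_sum:
  fixes u :: "nat \<Rightarrow> complex^'m" and v :: "nat \<Rightarrow> complex^'n"
  assumes "orthonormal_system (min CARD('m) CARD('n)) u" "orthonormal_system (min CARD('m) CARD('n)) v"
  shows "(norm (dyad_sum (\<lambda>k. of_real (g k)) u v))\<^sup>2 = (\<Sum>k<min CARD('m) CARD('n). (g k)\<^sup>2)"
proof -
  define N where "N = min CARD('m) CARD('n)"
  have "(norm (dyad_sum (\<lambda>k. of_real (g k)) u v))\<^sup>2
    = (\<Sum>j<N. \<Sum>k<N. g j * g k * Re (cip (u j) (u k) * cnj (cip (v j) (v k))))"
    by (simp add: power2_norm_eq_inner inner_dyad_sum N_def)
  also have "\<dots> = (\<Sum>j<N. \<Sum>k<N. if j = k then (g j)\<^sup>2 else 0)"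
    using assms by (intro sum.cong) (auto simp: orthonormal_system_cip power2_eq_square N_def)
  finally show ?thesis by (simp add: N_def)
qed

text \<open>The mixed terms of the expansion involve \<open>Re (a * cnj b) = cmod (a + b)\<^sup>2 / 4 - cmod (a - b)\<^sup>2 / 4\<close>
  for inner products \<open>a\<close>, \<open>b\<close> of singular vectors; completing squares with these two nonnegative
  weights leaves diagonal remainders that are nonnegative by Bessel's inequality.\<close>

lemma norm_dyad_sum_diff_squares:
  fixes u u' :: "nat \<Rightarrow> complex^'m" and v v' :: "nat \<Rightarrow> complex^'n"
  defines "N \<equiv> min CARD('m) CARD('n)"
  assumes u: "orthonormal_system N u" and v: "orthonormal_system N v"
    and u': "orthonormal_system N u'" and v': "orthonormal_system N v'"
  obtains p q :: "nat \<Rightarrow> nat \<Rightarrow> real" and d e :: "nat \<Rightarrow> real"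
  where "\<And>j k. 0 \<le> p j k" "\<And>j k. 0 \<le> q j k"
    "\<And>j. j < N \<Longrightarrow> 0 \<le> d j" "\<And>k. k < N \<Longrightarrow> 0 \<le> e k"
    "\<And>g h. (norm (dyad_sum (\<lambda>k. of_real (g k)) u v - dyad_sum (\<lambda>k. of_real (h k)) u' v'))\<^sup>2
      = (\<Sum>j<N. \<Sum>k<N. p j k * (g j - h k)\<^sup>2 + q j k * (g j + h k)\<^sup>2)
        + (\<Sum>j<N. d j * (g j)\<^sup>2) + (\<Sum>k<N. e k * (h k)\<^sup>2)"
proof -
  define a b where "a j k = cip (u j) (u' k)" and "b j k = cip (v j) (v' k)" for j k
  define p q where "p j k = (cmod (a j k + b j k))\<^sup>2 / 4"
    and "q j k = (cmod (a j k - b j k))\<^sup>2 / 4" for j k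
  \<comment> \<open>What the weights in row \<open>j\<close> and in column \<open>k\<close> leave
    over from 1.\<close>
  define d e where "d j = 1 - (\<Sum>k<N. p j k + q j k)"
    and "e k = 1 - (\<Sum>j<N. p j k + q j k)" for j k
  \<comment> \<open>Parallelogram law for the sum, polarization for the difference.\<close>
  have pq: "p j k + q j k = ((cmod (a j k))\<^sup>2 + (cmod (b j k))\<^sup>2) / 2"
    and pq': "p j k - q j k = Re (a j k * cnj (b j k))" for j k
    unfolding p_def q_def cmod_power2 by (simp_all add: power2_eq_square field_simps)
  have row: "(\<Sum>k<N. (cmod (a j k))\<^sup>2) \<le> 1" "(\<Sum>k<N. (cmod (b j k))\<^sup>2) \<le> 1" if "j < N" for j
    using Bessel_inequality[OF u', of "u j"] Bessel_inequality[OF v', of "v j"]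
    by (simp_all add: a_def b_def orthonormal_norm[OF u that] orthonormal_norm[OF v that])
  have sym: "cmod (a j k) = cmod (cip (u' k) (u j))" "cmod (b j k) = cmod (cip (v' k) (v j))" for j k
    unfolding a_def b_def by (metis cnj_cip complex_mod_cnj)+
  have col: "(\<Sum>j<N. (cmod (a j k))\<^sup>2) \<le> 1" "(\<Sum>j<N. (cmod (b j k))\<^sup>2) \<le> 1" if "k < N" for k
    using Bessel_inequality[OF u, of "u' k"] Bessel_inequality[OF v, of "v' k"]
    by (simp_all add: sym orthonormal_norm[OF u' that] orthonormal_norm[OF v' that])
  show thesis
  proof (rule that[of p q d e])
    show "0 \<le> p j k" "0 \<le> q j k" for j k by (simp_all add: p_def q_def)
    show "0 \<le> d j" if "j < N" for j
      using row[OF that] by (simp add: d_def pq sum.distrib flip: sum_divide_distrib)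
    show "0 \<le> e k" if "k < N" for k
      using col[OF that] by (simp add: e_def pq sum.distrib flip: sum_divide_distrib)
    fix g h :: "nat \<Rightarrow> real"
    let ?G = "dyad_sum (\<lambda>k. of_real (g k)) u v" and ?H = "dyad_sum (\<lambda>k. of_real (h k)) u' v'"
    have "(norm (?G - ?H))\<^sup>2 = (norm ?G)\<^sup>2 + (norm ?H)\<^sup>2 - 2 * (?G \<bullet> ?H)"
      by (simp add: power2_norm_eq_inner inner_diff_left inner_diff_right inner_commute)
    also have "\<dots> = (\<Sum>j<N. (g j)\<^sup>2) + (\<Sum>k<N. (h k)\<^sup>2)
        - (\<Sum>j<N. \<Sum>k<N. 2 * (g j * h k * (p j k - q j k)))"
      using norm_dyad_sum[OF u[unfolded N_def] v[unfolded N_def], of g]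
        norm_dyad_sum[OF u'[unfolded N_def] v'[unfolded N_def], of h]
      by (simp add: inner_dyad_sum pq' a_def b_def N_def sum_distrib_left)
    \<comment> \<open>Termwise, \<open>p (g - h)^2 + q (g + h)^2 = (p + q) (g^2 + h^2) - 2 g h (p -
      q)\<close>.\<close>
    also have "(\<Sum>j<N. \<Sum>k<N. 2 * (g j * h k * (p j k - q j k)))
      = (\<Sum>j<N. \<Sum>k<N. (p j k + q j k) * (g j)\<^sup>2) + (\<Sum>j<N. \<Sum>k<N. (p j k + q j k) * (h k)\<^sup>2)
        - (\<Sum>j<N. \<Sum>k<N. p j k * (g j - h k)\<^sup>2 + q j k * (g j + h k)\<^sup>2)"
      unfolding sum_subtractf[symmetric] sum.distrib[symmetric]
      by (intro sum.cong refl) (simp add: power2_eq_square algebra_simps)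
    also have "(\<Sum>j<N. \<Sum>k<N. (p j k + q j k) * (g j)\<^sup>2) = (\<Sum>j<N. (1 - d j) * (g j)\<^sup>2)"
      by (simp add: d_def sum_distrib_right)
    also have "(\<Sum>j<N. \<Sum>k<N. (p j k + q j k) * (h k)\<^sup>2) = (\<Sum>k<N. (1 - e k) * (h k)\<^sup>2)"
      by (subst sum.swap) (simp add: e_def sum_distrib_right)
    finally show "(norm (?G - ?H))\<^sup>2
      = (\<Sum>j<N. \<Sum>k<N. p j k * (g j - h k)\<^sup>2 + q j k * (g j + h k)\<^sup>2)
        + (\<Sum>j<N. d j * (g j)\<^sup>2) + (\<Sum>k<N. e k * (h k)\<^sup>2)"
      by (simp add: left_diff_distrib sum_subtractf)
  qed
qed

text \<open>The weights do not depend on the coefficients, so one expansion serves real parts,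
  imaginary parts and singular values, and the squares compare term by term. The last two bounds in
  \<open>Lip\<close> encode the comparison with the value 0 at 0.\<close>

lemma dyad_sum_Lipschitz_Re_Im:
  fixes u u' :: "nat \<Rightarrow> complex^'m" and v v' :: "nat \<Rightarrow> complex^'n"
  defines "N \<equiv> min CARD('m) CARD('n)"
  assumes orth: "orthonormal_system N u" "orthonormal_system N v"
      "orthonormal_system N u'" "orthonormal_system N v'"
    and pos: "\<And>j. j < N \<Longrightarrow> 0 \<le> s j" "\<And>k. k < N \<Longrightarrow> 0 \<le> t k" "0 \<le> L"
    and Lip: "\<And>j k. j < N \<Longrightarrow> k < N \<Longrightarrow> cmod (c j - c' k) \<le> L * \<bar>s j - t k\<bar>"
      "\<And>j. j < N \<Longrightarrow> cmod (c j) \<le> L * s j" "\<And>k. k < N \<Longrightarrow> cmod (c' k) \<le> L * t k"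
  shows "(norm (dyad_sum (\<lambda>k. of_real (Re (c k))) u v - dyad_sum (\<lambda>k. of_real (Re (c' k))) u' v'))\<^sup>2
    + (norm (dyad_sum (\<lambda>k. of_real (Im (c k))) u v - dyad_sum (\<lambda>k. of_real (Im (c' k))) u' v'))\<^sup>2
    \<le> L\<^sup>2 * (norm (dyad_sum (\<lambda>k. of_real (s k)) u v - dyad_sum (\<lambda>k. of_real (t k)) u' v'))\<^sup>2"
proof -
  note squares = norm_dyad_sum_diff_squares[OF orth[unfolded N_def], folded N_def]
  have sq: "(Re z)\<^sup>2 + (Im z)\<^sup>2 \<le> L\<^sup>2 * x\<^sup>2" if "cmod z \<le> L * \<bar>x\<bar>" for z x
    using power_mono[OF that norm_ge_zero, of 2] by (simp add: cmod_power2 power_mult_distrib)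
  have minus: "(Re (c j) - Re (c' k))\<^sup>2 + (Im (c j) - Im (c' k))\<^sup>2 \<le> L\<^sup>2 * (s j - t k)\<^sup>2"
    if "j < N" "k < N" for j k
    using sq[OF Lip(1)[OF that]] by simp
  \<comment> \<open>Sums are controlled by the separate bounds at \<open>s j\<close> and
    \<open>t k\<close>, which add up because both numbers are nonnegative.\<close>
  have plus: "(Re (c j) + Re (c' k))\<^sup>2 + (Im (c j) + Im (c' k))\<^sup>2 \<le> L\<^sup>2 * (s j + t k)\<^sup>2"
    if "j < N" "k < N" for j k
  proof -
    have "cmod (c j + c' k) \<le> L * \<bar>s j + t k\<bar>"
      using norm_triangle_ineq[of "c j" "c' k"] Lip(2,3) pos that
      by (simp add: distrib_left) (smt (verit))
    from sq[OF this] show ?thesis by simp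
  qed
  have one: "(Re (c j))\<^sup>2 + (Im (c j))\<^sup>2 \<le> L\<^sup>2 * (s j)\<^sup>2"
    "(Re (c' j))\<^sup>2 + (Im (c' j))\<^sup>2 \<le> L\<^sup>2 * (t j)\<^sup>2" if "j < N" for j
    using sq[of "c j" "s j"] sq[of "c' j" "t j"] Lip(2,3)[OF that] pos(1,2)[OF that] by simp_all
  show ?thesis
  proof (rule squares)
    fix p q :: "nat \<Rightarrow> nat \<Rightarrow> real" and d e :: "nat \<Rightarrow> real"
    assume nonneg: "\<And>j k. 0 \<le> p j k" "\<And>j k. 0 \<le> q j k"
      "\<And>j. j < N \<Longrightarrow> 0 \<le> d j" "\<And>k. k < N \<Longrightarrow> 0 \<le> e k"
      and expand: "\<And>g h. (norm (dyad_sum (\<lambda>k. of_real (g k)) u v - dyad_sum (\<lambda>k. of_real (h k)) u' v'))\<^sup>2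
      = (\<Sum>j<N. \<Sum>k<N. p j k * (g j - h k)\<^sup>2 + q j k * (g j + h k)\<^sup>2)
        + (\<Sum>j<N. d j * (g j)\<^sup>2) + (\<Sum>k<N. e k * (h k)\<^sup>2)"
    have "(\<Sum>j<N. \<Sum>k<N. p j k * (Re (c j) - Re (c' k))\<^sup>2 + q j k * (Re (c j) + Re (c' k))\<^sup>2)
       + (\<Sum>j<N. \<Sum>k<N. p j k * (Im (c j) - Im (c' k))\<^sup>2 + q j k * (Im (c j) + Im (c' k))\<^sup>2)
       = (\<Sum>j<N. \<Sum>k<N. p j k * ((Re (c j) - Re (c' k))\<^sup>2 + (Im (c j) - Im (c' k))\<^sup>2)
           + q j k * ((Re (c j) + Re (c' k))\<^sup>2 + (Im (c j) + Im (c' k))\<^sup>2))"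
      unfolding sum.distrib[symmetric] by (intro sum.cong refl) (simp add: algebra_simps)
    also have "\<dots> \<le> (\<Sum>j<N. \<Sum>k<N. p j k * (L\<^sup>2 * (s j - t k)\<^sup>2) + q j k * (L\<^sup>2 * (s j + t k)\<^sup>2))"
      by (intro sum_mono add_mono mult_left_mono minus plus nonneg) auto
    finally have 1: "(\<Sum>j<N. \<Sum>k<N. p j k * (Re (c j) - Re (c' k))\<^sup>2 + q j k * (Re (c j) + Re (c' k))\<^sup>2)
       + (\<Sum>j<N. \<Sum>k<N. p j k * (Im (c j) - Im (c' k))\<^sup>2 + q j k * (Im (c j) + Im (c' k))\<^sup>2)
       \<le> L\<^sup>2 * (\<Sum>j<N. \<Sum>k<N. p j k * (s j - t k)\<^sup>2 + q j k * (s j + t k)\<^sup>2)"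
      by (simp add: sum_distrib_left algebra_simps)
    have diag: "(\<Sum>j<N. w j * (Re (z j))\<^sup>2) + (\<Sum>j<N. w j * (Im (z j))\<^sup>2) \<le> L\<^sup>2 * (\<Sum>j<N. w j * (x j)\<^sup>2)"
      if "\<And>j. j < N \<Longrightarrow> 0 \<le> w j" "\<And>j. j < N \<Longrightarrow> (Re (z j))\<^sup>2 + (Im (z j))\<^sup>2 \<le> L\<^sup>2 * (x j)\<^sup>2"
      for w x :: "nat \<Rightarrow> real" and z :: "nat \<Rightarrow> complex"
    proof -
      have "(\<Sum>j<N. w j * ((Re (z j))\<^sup>2 + (Im (z j))\<^sup>2)) \<le> (\<Sum>j<N. w j * (L\<^sup>2 * (x j)\<^sup>2))"
        using that by (intro sum_mono mult_left_mono) auto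
      then show ?thesis by (simp add: distrib_left sum.distrib sum_distrib_left mult.left_commute)
    qed
    have 2: "(\<Sum>j<N. d j * (Re (c j))\<^sup>2) + (\<Sum>j<N. d j * (Im (c j))\<^sup>2) \<le> L\<^sup>2 * (\<Sum>j<N. d j * (s j)\<^sup>2)"
      by (intro diag nonneg one)
    have 3: "(\<Sum>j<N. e j * (Re (c' j))\<^sup>2) + (\<Sum>j<N. e j * (Im (c' j))\<^sup>2) \<le> L\<^sup>2 * (\<Sum>j<N. e j * (t j)\<^sup>2)"
      by (intro diag nonneg one)
    show ?thesis
      unfolding expand distrib_left using 1 2 3 by linarith
  qed
qed

lemma dyad_sum_Re_Im:
  "dyad_sum c u v = dyad_sum (\<lambda>k. of_real (Re (c k))) u v
    + (\<chi> i j. \<i> * dyad_sum (\<lambda>k. of_real (Im (c k))) u v $ i $ j)"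
proof -
  have "c k * x * y = of_real (Re (c k)) * x * y + \<i> * (of_real (Im (c k)) * x * y)" for k x y
    by (subst (1) complex_eq[of "c k"]) (simp add: algebra_simps)
  then show ?thesis
    unfolding dyad_sum_def by (simp add: vec_eq_iff sum_distrib_left sum.distrib)
qed

lemma norm_i_times_matrix: "norm (\<chi> i j. \<i> * A $ i $ j) = norm (A :: complex^'n^'m)"
  by (simp add: norm_matrix_frobenius norm_mult)

text \<open>The bounds are required only at the singular values that occur, so the estimate also
  applies to an \<open>f\<close> that is not Lipschitz on the half-line. For real \<open>f\<close>
  the matrix \<open>?Y\<close> drops out.\<close>

lemma svd_Lipschitz:
  fixes A B :: "complex^'n^'m"
  defines "N \<equiv> min CARD('m) CARD('n)"
  assumes A: "is_svd A s u v" and B: "is_svd B t u' v'" and L: "0 \<le> L"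
    and Lip: "\<And>j k. j < N \<Longrightarrow> k < N \<Longrightarrow> cmod (f (s j) - f (t k)) \<le> L * \<bar>s j - t k\<bar>"
      "\<And>j. j < N \<Longrightarrow> cmod (f (s j)) \<le> L * s j" "\<And>k. k < N \<Longrightarrow> cmod (f (t k)) \<le> L * t k"
  shows "norm (dyad_sum (\<lambda>k. f (s k)) u v - dyad_sum (\<lambda>k. f (t k)) u' v') \<le> sqrt 2 * L * norm (A - B)"
    and "(\<And>x. 0 \<le> x \<Longrightarrow> f x \<in> \<real>) \<Longrightarrow>
      norm (dyad_sum (\<lambda>k. f (s k)) u v - dyad_sum (\<lambda>k. f (t k)) u' v') \<le> L * norm (A - B)"
proof -
  let ?X = "dyad_sum (\<lambda>k. of_real (Re (f (s k)))) u v - dyad_sum (\<lambda>k. of_real (Re (f (t k)))) u' v'"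
  let ?Y = "dyad_sum (\<lambda>k. of_real (Im (f (s k)))) u v - dyad_sum (\<lambda>k. of_real (Im (f (t k)))) u' v'"
  let ?D = "dyad_sum (\<lambda>k. f (s k)) u v - dyad_sum (\<lambda>k. f (t k)) u' v'"
  have XY: "(norm ?X)\<^sup>2 + (norm ?Y)\<^sup>2 \<le> (L * norm (A - B))\<^sup>2"
    using A B dyad_sum_Lipschitz_Re_Im[of u v u' v' s t L "\<lambda>k. f (s k)" "\<lambda>k. f (t k)"] L Lip
    unfolding is_svd_def N_def power_mult_distrib by simp
  have D: "?D = ?X + (\<chi> i j. \<i> * ?Y $ i $ j)"
    by (subst (1 2) dyad_sum_Re_Im) (simp add: vec_eq_iff right_diff_distrib)
  \<comment> \<open>The parallelogram law. Since \<open>?X\<close> and \<open>?Y\<close> have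
    complex entries, \<open>?X\<close> and i times \<open>?Y\<close> need not be orthogonal; this is
    where the factor 2 is lost.\<close>
  have "(norm (x + y))\<^sup>2 \<le> 2 * ((norm x)\<^sup>2 + (norm y)\<^sup>2)" for x y :: "complex^'n^'m"
    using zero_le_power2[of "norm (x - y)"]
    by (simp add: power2_norm_eq_inner inner_simps inner_commute)
  then have "(norm ?D)\<^sup>2 \<le> 2 * ((norm ?X)\<^sup>2 + (norm ?Y)\<^sup>2)"
    by (metis D norm_i_times_matrix)
  with XY have "(norm ?D)\<^sup>2 \<le> (sqrt 2 * L * norm (A - B))\<^sup>2"
    by (simp add: power_mult_distrib)
  then show "norm ?D \<le> sqrt 2 * L * norm (A - B)"
    by (rule power2_le_imp_le) (simp add: L)
  assume real: "\<And>x. 0 \<le> x \<Longrightarrow> f x \<in> \<real>"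
  have "of_real (Re (f (s k))) = f (s k)" "of_real (Re (f (t k))) = f (t k)" if "k < N" for k
    using A B that real by (auto simp: is_svd_def N_def)
  then have "?D = ?X"
    by (simp add: dyad_sum_def N_def)
  with XY have "(norm ?D)\<^sup>2 \<le> (L * norm (A - B))\<^sup>2"
    by (smt (verit) zero_le_power2)
  then show "norm ?D \<le> L * norm (A - B)"
    by (rule power2_le_imp_le) (simp add: L)
qed

section \<open>Independence of the decomposition and the bound for the calculus\<close>

text \<open>The sum of all difference quotients serves as constant; equal points contribute 0
  because division by 0 yields 0.\<close>

lemma finite_Lipschitz:
  fixes f :: "'a::real_normed_vector \<Rightarrow> 'b::real_normed_vector"
  assumes "finite S"
  obtains L where "0 \<le> L" "\<And>x y. x \<in> S \<Longrightarrow> y \<in> S \<Longrightarrow> norm (f x - f y) \<le> L * norm (x - y)"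
proof -
  let ?q = "\<lambda>(x, y). norm (f x - f y) / norm (x - y)"
  have "norm (f x - f y) \<le> sum ?q (S \<times> S) * norm (x - y)" if "x \<in> S" "y \<in> S" for x y
  proof (cases "x = y")
    case False
    have "?q (x, y) \<le> sum ?q (S \<times> S)"
      using assms that by (intro member_le_sum) auto
    with False show ?thesis by (simp add: divide_le_eq)
  qed simp
  then show ?thesis
    by (rule that[rotated]) (auto intro: sum_nonneg)
qed

text \<open>Every \<open>f\<close> with \<open>f 0 = 0\<close> is Lipschitz on the finitely many singular values involved, so the
  Lipschitz estimate with \<open>A = B\<close> shows independence of the decomposition.\<close>

lemma svd_calculus_unique:
  fixes A :: "complex^'n^'m"
  assumes A: "is_svd A s u v" "is_svd A t u' v'" and f: "f 0 = 0"
  shows "dyad_sum (\<lambda>k. f (s k)) u v = (dyad_sum (\<lambda>k. f (t k)) u' v' :: complex^'n^'m)"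
proof -
  define N where "N = min CARD('m) CARD('n)"
  \<comment> \<open>The point 0 is included so that \<open>f 0 = 0\<close> yields the bounds on
    single values.\<close>
  obtain L where L: "0 \<le> L"
    "\<And>x y. x \<in> insert 0 (s ` {..<N} \<union> t ` {..<N}) \<Longrightarrow> y \<in> insert 0 (s ` {..<N} \<union> t ` {..<N})
      \<Longrightarrow> cmod (f x - f y) \<le> L * norm (x - y)"
    using finite_Lipschitz[of "insert 0 (s ` {..<N} \<union> t ` {..<N})" f] by (metis finite_UnI finite_imageI finite_insert finite_lessThan)
  have pos: "0 \<le> s k" "0 \<le> t k" if "k < N" for k
    using A that by (simp_all add: is_svd_def N_def)
  have "cmod (f (s k)) \<le> L * s k" "cmod (f (t k)) \<le> L * t k" if "k < N" for k
    using L(2)[of "s k" 0] L(2)[of "t k" 0] pos[OF that] that f by auto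
  moreover have "cmod (f (s j) - f (t k)) \<le> L * \<bar>s j - t k\<bar>" if "j < N" "k < N" for j k
    using L(2)[of "s j" "t k"] that by auto
  ultimately have "norm (dyad_sum (\<lambda>k. f (s k)) u v - dyad_sum (\<lambda>k. f (t k)) u' v') \<le> sqrt 2 * L * norm (A - A)"
    by (intro svd_Lipschitz(1)[OF A L(1)]) (simp_all add: N_def)
  then show ?thesis by simp
qed

lemma sv_calculus_eq:
  fixes A :: "complex^'n^'m"
  assumes "is_svd A s u v" "f 0 = 0"
  shows "sv_calculus f A = dyad_sum (\<lambda>k. f (s k)) u v"
  unfolding sv_calculus_def
proof (rule the_equality)
  show "\<exists>s' u' v'. is_svd A s' u' v' \<and> dyad_sum (\<lambda>k. f (s k)) u v = dyad_sum (\<lambda>k. f (s' k)) u' v'"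
    by (rule exI[of _ s], rule exI[of _ u], rule exI[of _ v]) (simp add: assms(1))
  show "X = dyad_sum (\<lambda>k. f (s k)) u v"
    if "\<exists>s u v. is_svd A s u v \<and> X = dyad_sum (\<lambda>k. f (s k)) u v" for X
    using that svd_calculus_unique[where f = f, OF _ assms] by (elim exE conjE) simp
qed

lemma sv_calculus_Lipschitz:
  fixes A B :: "complex^'n^'m"
  assumes f: "f 0 = 0" and L: "0 \<le> L"
    and Lip: "\<And>x y. 0 \<le> x \<Longrightarrow> 0 \<le> y \<Longrightarrow> cmod (f x - f y) \<le> L * \<bar>x - y\<bar>"
  shows "norm (sv_calculus f A - sv_calculus f B) \<le> sqrt 2 * L * norm (A - B)"
    and "(\<And>x. 0 \<le> x \<Longrightarrow> f x \<in> \<real>) \<Longrightarrow> norm (sv_calculus f A - sv_calculus f B) \<le> L * norm (A - B)"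
proof -
  obtain s u v t u' v' where svd: "is_svd A s u v" "is_svd B t u' v'"
    using svd_exists[of A] svd_exists[of B] by (elim exE)
  have abs: "cmod (f x) \<le> L * x" if "0 \<le> x" for x
    using Lip[of x 0] f that by simp
  have eq: "sv_calculus f A = dyad_sum (\<lambda>k. f (s k)) u v" "sv_calculus f B = dyad_sum (\<lambda>k. f (t k)) u' v'"
    using svd f by (simp_all add: sv_calculus_eq)
  show "norm (sv_calculus f A - sv_calculus f B) \<le> sqrt 2 * L * norm (A - B)"
    unfolding eq using svd by (intro svd_Lipschitz(1)[OF svd L] Lip abs) (auto simp: is_svd_def)
  show "norm (sv_calculus f A - sv_calculus f B) \<le> L * norm (A - B)" if "\<And>x. 0 \<le> x \<Longrightarrow> f x \<in> \<real>"
    unfolding eq using svd that by (intro svd_Lipschitz(2)[OF svd L] Lip abs) (auto simp: is_svd_def)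
qed

subsection \<open>Lipschitz norms and the scalar case\<close>

lemma lip_norm_leI:
  assumes "0 \<le> K" "\<And>x y. x \<in> S \<Longrightarrow> y \<in> S \<Longrightarrow> norm (g x - g y) \<le> K * norm (x - y)"
  shows "lip_norm S g \<le> ennreal K"
  unfolding lip_norm_def
proof (rule SUP_least)
  fix z assume "z \<in> {(x, y). x \<in> S \<and> y \<in> S \<and> x \<noteq> y}"
  then show "(case z of (x, y) \<Rightarrow> ennreal (norm (g x - g y) / norm (x - y))) \<le> ennreal K"
    using assms by (auto simp: divide_le_eq intro!: ennreal_leI)
qed

lemma lip_norm_ge:
  assumes "x \<in> S" "y \<in> S" "x \<noteq> y"
  shows "ennreal (norm (g x - g y) / norm (x - y)) \<le> lip_norm S g"
  unfolding lip_norm_def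
  by (rule SUP_upper2[of "(x, y)"]) (use assms in auto)

text \<open>Finiteness matters here because \<open>enn2real\<close> sends the infinite value to
  0.\<close>

lemma norm_diff_le_lip_norm:
  assumes "lip_norm S g < top" "x \<in> S" "y \<in> S"
  shows "norm (g x - g y) \<le> enn2real (lip_norm S g) * norm (x - y)"
proof (cases "x = y")
  case False
  have "ennreal (norm (g x - g y) / norm (x - y)) \<le> ennreal (enn2real (lip_norm S g))"
    using lip_norm_ge[OF assms(2,3) False, of g] assms(1) by simp
  then have "norm (g x - g y) / norm (x - y) \<le> enn2real (lip_norm S g)"
    by (simp add: ennreal_le_iff)
  with False show ?thesis by (simp add: divide_le_eq)
qed simp

section \<open>Embedding of the scalars and lower bounds\<close>

text \<open>An isometric copy of the scalars inside the matrices of any size.\<close>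

definition single_entry :: "'m \<Rightarrow> 'n \<Rightarrow> complex \<Rightarrow> complex^'n^'m" where
  "single_entry i\<^sub>0 j\<^sub>0 z = (\<chi> i j. if i = i\<^sub>0 \<and> j = j\<^sub>0 then z else 0)"

lemma norm_single_entry: "norm (single_entry i\<^sub>0 j\<^sub>0 z) = cmod z"
proof -
  have "(\<Sum>i\<in>UNIV. \<Sum>j\<in>UNIV. (cmod (single_entry i\<^sub>0 j\<^sub>0 z $ i $ j))\<^sup>2)
    = (\<Sum>i\<in>UNIV. \<Sum>j\<in>UNIV. if i = i\<^sub>0 then (if j = j\<^sub>0 then (cmod z)\<^sup>2 else 0) else 0)"
    by (intro sum.cong) (auto simp: single_entry_def)
  also have "\<dots> = (\<Sum>i\<in>UNIV. if i = i\<^sub>0 then (cmod z)\<^sup>2 else 0)"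
    by (intro sum.cong) auto
  finally show ?thesis
    by (simp add: norm_matrix_frobenius)
qed

lemma single_entry_diff: "single_entry i\<^sub>0 j\<^sub>0 z - single_entry i\<^sub>0 j\<^sub>0 w = single_entry i\<^sub>0 j\<^sub>0 (z - w)"
  by (simp add: single_entry_def vec_eq_iff)

lemma cip_axis: "cip (axis i a) (axis j b) = (if i = j then a * cnj b else 0)"
proof -
  have "cip (axis i a) (axis j b) = (\<Sum>k\<in>UNIV. if k = i then (if i = j then a * cnj b else 0) else 0)"
    unfolding cip_def by (intro sum.cong) (auto simp: axis_def)
  then show ?thesis by simp
qed

text \<open>The unimodular factors make room for the phase of a complex entry.\<close>

lemma orthonormal_system_axis:
  assumes "inj_on h {..<r}" "\<And>k. k < r \<Longrightarrow> cmod (c k) = 1"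
  shows "orthonormal_system r (\<lambda>k. axis (h k) (c k))"
  using assms by (auto simp: orthonormal_system_cip cip_axis inj_on_def simp flip: complex_norm_square)

text \<open>A decomposition is explicit: the singular value \<open>cmod z\<close> comes first with
  the phase in its left vector, then zeros with further standard basis vectors.\<close>

lemma sv_calculus_single_entry:
  obtains i\<^sub>0 :: "'m::finite" and j\<^sub>0 :: "'n::finite" where
    "\<And>f z. f 0 = 0 \<Longrightarrow> sv_calculus f (single_entry i\<^sub>0 j\<^sub>0 z :: complex^'n^'m)
      = single_entry i\<^sub>0 j\<^sub>0 (f (cmod z) * sgn z)"
proof -
  define N where "N = min CARD('m) CARD('n)"
  obtain h :: "nat \<Rightarrow> 'm" where h: "bij_betw h {..<CARD('m)} UNIV"
    using ex_bij_betw_nat_finite[of "UNIV :: 'm set"] by (auto simp: atLeast0LessThan)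
  obtain h' :: "nat \<Rightarrow> 'n" where h': "bij_betw h' {..<CARD('n)} UNIV"
    using ex_bij_betw_nat_finite[of "UNIV :: 'n set"] by (auto simp: atLeast0LessThan)
  have inj: "inj_on h {..<N}" "inj_on h' {..<N}"
    using h h' by (auto simp: bij_betw_def N_def intro: inj_on_subset)
  have "0 < N" by (simp add: N_def)
  show thesis
  proof (rule that[of "h 0" "h' 0"])
    fix f :: "real \<Rightarrow> complex" and z :: complex
    assume f: "f 0 = 0"
    define s where "s k = (if k = 0 then cmod z else 0)" for k :: nat
    \<comment> \<open>The phase is 1 for \<open>z = 0\<close>, where \<open>sgn z\<close> is 0 and
      not unimodular.\<close>
    define u where "u k = axis (h k) (if k = 0 \<and> z \<noteq> 0 then sgn z else 1)" for k
    define v where "v k = axis (h' k) (1 :: complex)" for k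
    \<comment> \<open>A general \<open>g\<close> covers both the decomposition itself, with
      \<open>complex_of_real\<close>, and the value of the calculus.\<close>
    have sum: "dyad_sum (\<lambda>k. g (s k)) u v = single_entry (h 0) (h' 0) (g (cmod z) * sgn z)"
      if "g 0 = 0" for g
    proof -
      have "(\<Sum>k<N. g (s k) * u k $ i * cnj (v k $ j)) = (\<Sum>k\<in>{0}. g (s k) * u k $ i * cnj (v k $ j))" for i j
        using \<open>0 < N\<close> that by (intro sum.mono_neutral_right) (auto simp: s_def)
      then show ?thesis
        using that by (auto simp: dyad_sum_def N_def[symmetric] single_entry_def vec_eq_iff s_def u_def v_def axis_def)
    qed
    have "is_svd (single_entry (h 0) (h' 0) z) s u v"
      unfolding is_svd_def N_def[symmetric]
    proof (intro conjI allI impI)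
      show "0 \<le> s k" for k by (simp add: s_def)
      show "orthonormal_system N u" "orthonormal_system N v"
        unfolding u_def[abs_def] v_def[abs_def]
        by (intro orthonormal_system_axis inj; simp add: norm_sgn)+
      have "of_real (cmod z) * sgn z = z"
        by (simp add: sgn_eq)
      then show "single_entry (h 0) (h' 0) z = dyad_sum (\<lambda>k. complex_of_real (s k)) u v"
        by (simp add: sum)
    qed
    then show "sv_calculus f (single_entry (h 0) (h' 0) z) = single_entry (h 0) (h' 0) (f (cmod z) * sgn z)"
      using f by (simp add: sv_calculus_eq sum)
  qed
qed

lemma lip_norm_sv_calculus_ge:
  assumes "f 0 = 0" "z \<noteq> w"
  shows "ennreal (cmod (f (cmod z) * sgn z - f (cmod w) * sgn w) / cmod (z - w))
    \<le> lip_norm UNIV (sv_calculus f :: complex^'n^'m \<Rightarrow> complex^'n^'m)"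
proof (rule sv_calculus_single_entry)
  fix i\<^sub>0 :: "'m::finite" and j\<^sub>0 :: "'n::finite"
  assume E: "\<And>f z. f 0 = 0 \<Longrightarrow> sv_calculus f (single_entry i\<^sub>0 j\<^sub>0 z :: complex^'n^'m)
      = single_entry i\<^sub>0 j\<^sub>0 (f (cmod z) * sgn z)"
  let ?E = "single_entry i\<^sub>0 j\<^sub>0 :: complex \<Rightarrow> complex^'n^'m"
  have "norm (?E z - ?E w) \<noteq> 0"
    unfolding single_entry_diff norm_single_entry using assms(2) by simp
  then have "?E z \<noteq> ?E w" by auto
  from lip_norm_ge[OF UNIV_I UNIV_I this, of "sv_calculus f"] show ?thesis
    by (simp add: E assms(1) single_entry_diff norm_single_entry)
qed

text \<open>On nonnegative real scalars the calculus reduces to \<open>f\<close> itself.\<close>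

lemma lip_norm_le_lip_norm_sv_calculus:
  assumes "f 0 = 0"
  shows "lip_norm {0..} f \<le> lip_norm UNIV (sv_calculus f :: complex^'n^'m \<Rightarrow> complex^'n^'m)"
  unfolding lip_norm_def[of "{0..}"]
proof (rule SUP_least, clarsimp)
  fix x y :: real
  assume xy: "0 \<le> x" "0 \<le> y" "x \<noteq> y"
  have unit: "f t * sgn (of_real t) = f t" if "0 \<le> t" for t
    using that assms by (cases "t = 0") (simp_all add: sgn_eq)
  have "f x * sgn (of_real x) - f y * sgn (of_real y) = f x - f y"
    by (simp only: unit[OF xy(1)] unit[OF xy(2)])
  with lip_norm_sv_calculus_ge[where 'n='n and 'm='m and f = f, OF assms, of "of_real x" "of_real y"] xy
  show "ennreal (cmod (f x - f y) / \<bar>x - y\<bar>)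
    \<le> lip_norm UNIV (sv_calculus f :: complex^'n^'m \<Rightarrow> complex^'n^'m)"
    by (simp flip: of_real_diff)
qed

section \<open>Upper bounds for the Lipschitz norm\<close>

lemma lip_norm_sv_calculus_le:
  assumes "f 0 = 0"
  shows "lip_norm UNIV (sv_calculus f :: complex^'n^'m \<Rightarrow> complex^'n^'m) \<le> ennreal (sqrt 2) * lip_norm {0..} f"
    and "(\<And>x. 0 \<le> x \<Longrightarrow> f x \<in> \<real>) \<Longrightarrow>
      lip_norm UNIV (sv_calculus f :: complex^'n^'m \<Rightarrow> complex^'n^'m) \<le> lip_norm {0..} f"
proof -
  \<comment> \<open>\<open>L\<close> represents the Lipschitz norm only when that is finite; the
    infinite case is trivial and treated apart.\<close>
  define L where "L = enn2real (lip_norm {0..} f)"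
  have L: "0 \<le> L" by (simp add: L_def)
  have Lip: "cmod (f x - f y) \<le> L * \<bar>x - y\<bar>" if "lip_norm {0..} f < top" "0 \<le> x" "0 \<le> y" for x y
    using norm_diff_le_lip_norm[of "{0..}" f x y] that by (simp add: L_def)
  have fin: "lip_norm {0..} f = ennreal L" if "lip_norm {0..} f < top"
    using that by (simp add: L_def)
  show "lip_norm UNIV (sv_calculus f :: complex^'n^'m \<Rightarrow> complex^'n^'m) \<le> ennreal (sqrt 2) * lip_norm {0..} f"
  proof (cases "lip_norm {0..} f < top")
    case True
    have "lip_norm UNIV (sv_calculus f :: complex^'n^'m \<Rightarrow> complex^'n^'m) \<le> ennreal (sqrt 2 * L)"
      by (intro lip_norm_leI sv_calculus_Lipschitz(1) assms L Lip True) (simp_all add: L)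
    then show ?thesis by (simp add: fin[OF True] ennreal_mult L)
  next
    case False
    then have "lip_norm {0..} f = top" by (simp add: top.not_eq_extremum[symmetric])
    then show ?thesis by (simp add: ennreal_mult_top)
  qed
  show "lip_norm UNIV (sv_calculus f :: complex^'n^'m \<Rightarrow> complex^'n^'m) \<le> lip_norm {0..} f"
    if real: "\<And>x. 0 \<le> x \<Longrightarrow> f x \<in> \<real>"
  proof (cases "lip_norm {0..} f < top")
    case True
    show ?thesis
      unfolding fin[OF True]
      by (intro lip_norm_leI sv_calculus_Lipschitz(2) assms L Lip True real)
  next
    case False
    then show ?thesis by (simp add: top.not_eq_extremum[symmetric])
  qed
qed

section \<open>Sharpness of the constant\<close>

text \<open>A unit-speed path from 0 straight to -i that turns at time 1 by a right angle, into the
  direction of the positive reals.\<close>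

definition bent :: "real \<Rightarrow> complex" where
  "bent x = Complex (max 0 (x - 1)) (- min x 1)"

text \<open>Both \<open>max 0 (x - 1)\<close> and \<open>min x 1\<close> are monotone and they add
  up to \<open>x\<close>, so their absolute increments add up to that of \<open>x\<close>.\<close>

lemma bent_Lipschitz: "cmod (bent x - bent y) \<le> 1 * norm (x - y)"
proof -
  have "cmod (bent x - bent y) \<le> \<bar>max 0 (x - 1) - max 0 (y - 1)\<bar> + \<bar>min x 1 - min y 1\<bar>"
    using cmod_le[of "bent x - bent y"] by (simp add: bent_def abs_minus_commute)
  then show ?thesis by (auto simp: max_def min_def split: if_splits)
qed

lemma bent_zero: "bent 0 = 0"
  by (simp add: bent_def complex_eq_iff)

text \<open>The point \<open>(1 + t) * cis t\<close> leaves 1 in the direction 1 + i, in which the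
  differential \<open>(x, y) \<mapsto> x + y\<close> attains its norm.\<close>

lemma bent_quotient_limit:
  "((\<lambda>t. cmod (bent (1 + t) * cis t - bent 1) / cmod (of_real (1 + t) * cis t - 1)) \<longlongrightarrow> sqrt 2) (at_right 0)"
proof -
  \<comment> \<open>Entire functions that agree, for real \<open>t > 0\<close>, with numerator and
    denominator inside \<open>cmod\<close>; their derivatives at 0 are 2 and 1 + i.\<close>
  define F G :: "complex \<Rightarrow> complex" where "F z = (z - \<i>) * exp (\<i> * z) + \<i>"
    and "G z = (1 + z) * exp (\<i> * z) - 1" for z
  have "(F has_field_derivative 2) (at 0)"
    unfolding F_def by (auto intro!: derivative_eq_intros)
  moreover have "(G has_field_derivative (1 + \<i>)) (at 0)"
    unfolding G_def by (auto intro!: derivative_eq_intros)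
  ultimately have "((\<lambda>z. (F z / z) / (G z / z)) \<longlongrightarrow> 2 / (1 + \<i>)) (at 0)"
    by (intro tendsto_divide) (auto simp: has_field_derivative_iff F_def G_def complex_eq_iff)
  then have "((\<lambda>z. cmod ((F z / z) / (G z / z))) \<longlongrightarrow> cmod (2 / (1 + \<i>))) (at 0)"
    by (rule tendsto_norm)
  moreover have "cmod (2 / (1 + \<i>)) = sqrt 2"
    by (simp only: norm_divide) (simp add: cmod_def real_div_sqrt)
  moreover have "filterlim complex_of_real (at 0) (at_right 0)"
    unfolding filterlim_at by (auto intro!: tendsto_eq_intros simp: eventually_at_right_less eventually_at_filter)
  ultimately have "((\<lambda>t. cmod ((F (of_real t) / of_real t) / (G (of_real t) / of_real t))) \<longlongrightarrow> sqrt 2) (at_right 0)"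
    using filterlim_compose by fastforce
  moreover have "eventually (\<lambda>t. cmod ((F (of_real t) / of_real t) / (G (of_real t) / of_real t))
      = cmod (bent (1 + t) * cis t - bent 1) / cmod (of_real (1 + t) * cis t - 1)) (at_right 0)"
    using eventually_at_right_less[of 0]
  proof eventually_elim
    case (elim t)
    have "bent (1 + t) = of_real t - \<i>" "bent 1 = - \<i>"
      using elim by (simp_all add: bent_def complex_eq_iff)
    then show ?case
      using elim by (simp add: F_def G_def cis_conv_exp norm_divide)
  qed
  ultimately show ?thesis
    by (rule Lim_transform_eventually)
qed

lemma bent_sharp:
  assumes "C < sqrt 2"
  shows "ennreal C * lip_norm {0..} bent < lip_norm UNIV (sv_calculus bent :: complex^'n^'m \<Rightarrow> complex^'n^'m)"
proof -
  \<comment> \<open>With \<open>D\<close> nonnegative, any quotient above \<open>D\<close> is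
    positive, so the strict inequality survives the passage to \<open>ennreal\<close>.\<close>
  define D where "D = max C 0"
  have "D < sqrt 2" using assms by (simp add: D_def)
  then have "eventually (\<lambda>t. D < cmod (bent (1 + t) * cis t - bent 1) / cmod (of_real (1 + t) * cis t - 1)) (at_right 0)"
    using bent_quotient_limit by (rule order_tendstoD(1)[rotated])
  moreover have "eventually (\<lambda>t::real. 0 < t) (at_right 0)"
    by (rule eventually_at_right_less)
  ultimately obtain t where t: "0 < t"
    "D < cmod (bent (1 + t) * cis t - bent 1) / cmod (of_real (1 + t) * cis t - 1)"
    using eventually_happens[OF eventually_conj] trivial_limit_at_right_real by blast
  define z where "z = of_real (1 + t) * cis t"
  have z: "cmod z = 1 + t" using t(1) by (simp add: z_def norm_mult del: of_real_add)
  then have "sgn z = cis t" using t(1) by (simp add: sgn_eq z_def del: of_real_add)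
  moreover have "z \<noteq> 1" using z t(1) by auto
  ultimately have "ennreal (cmod (bent (1 + t) * cis t - bent 1) / cmod (z - 1))
      \<le> lip_norm UNIV (sv_calculus bent :: complex^'n^'m \<Rightarrow> complex^'n^'m)"
    using lip_norm_sv_calculus_ge[where f = bent, OF bent_zero, of z 1] by (simp add: z)
  moreover have "ennreal C * lip_norm {0..} bent \<le> ennreal D * ennreal 1"
    by (intro mult_mono lip_norm_leI bent_Lipschitz) (auto simp: D_def intro: ennreal_leI)
  moreover have "ennreal D < ennreal (cmod (bent (1 + t) * cis t - bent 1) / cmod (z - 1))"
    using t(2) by (intro ennreal_lessI) (auto simp: z_def D_def)
  ultimately show ?thesis by simp
qed

theorem theorem1p1:
  shows "(\<forall>f :: real \<Rightarrow> complex. continuous_on {0..} f \<and> f 0 = 0 \<longrightarrow>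
            lip_norm UNIV (sv_calculus f :: complex^'n^'m \<Rightarrow> complex^'n^'m)
              \<le> ennreal (sqrt 2) * lip_norm {0..} f)
       \<and> (\<forall>C :: real. C < sqrt 2 \<longrightarrow>
            (\<exists>f :: real \<Rightarrow> complex. (\<exists>L. L-lipschitz_on {0..} f) \<and> f 0 = 0 \<and>
              lip_norm UNIV (sv_calculus f :: complex^'n^'m \<Rightarrow> complex^'n^'m)
                > ennreal C * lip_norm {0..} f))
       \<and> (\<forall>f :: real \<Rightarrow> complex. continuous_on {0..} f \<and> f 0 = 0 \<and> (\<forall>x\<ge>0. f x \<in> \<real>) \<longrightarrow>
            lip_norm UNIV (sv_calculus f :: complex^'n^'m \<Rightarrow> complex^'n^'m)
              = lip_norm {0..} f)"
proof (intro conjI allI impI)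
  fix f :: "real \<Rightarrow> complex"
  assume "continuous_on {0..} f \<and> f 0 = 0"
  then show "lip_norm UNIV (sv_calculus f :: complex^'n^'m \<Rightarrow> complex^'n^'m)
      \<le> ennreal (sqrt 2) * lip_norm {0..} f"
    by (intro lip_norm_sv_calculus_le(1)) simp
next
  fix C :: real
  assume "C < sqrt 2"
  moreover have "1-lipschitz_on {0..} bent"
    using bent_Lipschitz by (intro lipschitz_onI) (simp_all add: dist_norm)
  ultimately show "\<exists>f :: real \<Rightarrow> complex. (\<exists>L. L-lipschitz_on {0..} f) \<and> f 0 = 0 \<and>
      lip_norm UNIV (sv_calculus f :: complex^'n^'m \<Rightarrow> complex^'n^'m) > ennreal C * lip_norm {0..} f"
    using bent_zero bent_sharp by (intro exI[of _ bent]) blast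
next
  fix f :: "real \<Rightarrow> complex"
  assume "continuous_on {0..} f \<and> f 0 = 0 \<and> (\<forall>x\<ge>0. f x \<in> \<real>)"
  then show "lip_norm UNIV (sv_calculus f :: complex^'n^'m \<Rightarrow> complex^'n^'m) = lip_norm {0..} f"
    by (intro antisym lip_norm_sv_calculus_le(2) lip_norm_le_lip_norm_sv_calculus) simp_all
qed

end
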